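(* Let $G$ be a finite non-cyclic group. Then the following hold: (i) The graph $\overline{\mathcal{P}_E(G^* )}$ is unicyclic if and only if $G$ is isomorphic to $\mathbb{Z}_2\times\mathbb{Z}_2$. (ii) The graph $\overline{\mathcal{P}_E(G^* )}$ is pentacyclic if and only if $G$ is isomorphic to $S_3$. (iii) The graph $\overline{\mathcal{P}_E(G^* )}$ cannot be bicyclic, tricyclic, or tetracyclic.
   Context: The enhanced power graph $\mathcal{P}_E(G)$ of a group $G$ is the simple undirected graph with vertex set $G$ in which two distinct vertices $x,y$ are adjacent if $x,y\in\langle z\rangle$ for some $z\in G$. Its complement $\overline{\mathcal{P}_E(G)}$ has the same vertex set $G$, and distinct $x,y$ are adjacent in it if and only if they are not adjacent in $\mathcal{P}_E(G)$. The graph $\overline{\mathcal{P}_E(G^* )}$ is the subgraph of $\overline{\mathcal{P}_E(G)}$ induced by all the non-isolated vertices of $\overline{\mathcal{P}_E(G)}$ (this graph is connected). For a connected graph $\Gamma$ with $n$ vertices and $m$ edges, put $c(\Gamma)=m-n+1$; $\Gamma$ is called unicyclic, bicyclic, tricyclic, tetracyclic, pentacyclic if $c(\Gamma)=1,2,3,4,5$, respectively. *)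

theory Defs
  imports
    "HOL-Algebra.Algebra"
    "Graph_Theory.Digraph_Component"
begin

text \<open>
  As usual in \<open>Graph_Theory\<close>, a simple undirected graph is a symmetric, loop-free digraph
  without multiple arcs: an edge between x and y is the pair of arcs (x, y) and (y, x).
\<close>

definition simple_graph_on :: "'a set \<Rightarrow> ('a \<Rightarrow> 'a \<Rightarrow> bool) \<Rightarrow> ('a, 'a \<times> 'a) pre_digraph" where
  "simple_graph_on V adj =
     \<lparr>verts = V, arcs = {(x, y). x \<in> V \<and> y \<in> V \<and> x \<noteq> y \<and> adj x y}, tail = fst, head = snd\<rparr>"

definition enhanced_power_graph :: "('a, 'm) monoid_scheme \<Rightarrow> ('a, 'a \<times> 'a) pre_digraph" where
  "enhanced_power_graph G =
     simple_graph_on (carrier G)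
       (\<lambda>x y. \<exists>z \<in> carrier G. x \<in> generate G {z} \<and> y \<in> generate G {z})"

definition graph_complement :: "('a, 'b) pre_digraph \<Rightarrow> ('a, 'a \<times> 'a) pre_digraph" where
  "graph_complement \<Gamma> = simple_graph_on (verts \<Gamma>) (\<lambda>x y. \<not> x \<rightarrow>\<^bsub>\<Gamma>\<^esub> y)"

definition non_isolated_verts :: "('a, 'b) pre_digraph \<Rightarrow> 'a set" where
  "non_isolated_verts \<Gamma> = {x \<in> verts \<Gamma>. \<exists>y \<in> verts \<Gamma>. x \<rightarrow>\<^bsub>\<Gamma>\<^esub> y}"

definition proper_enhanced_power_graph_complement ::
    "('a, 'm) monoid_scheme \<Rightarrow> ('a, 'a \<times> 'a) pre_digraph" where
  "proper_enhanced_power_graph_complement G =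
     (let \<Gamma> = graph_complement (enhanced_power_graph G) in \<Gamma> \<restriction> non_isolated_verts \<Gamma>)"

text \<open>Unordered, so that each undirected edge is counted once rather than as two arcs.\<close>

definition undirected_edges :: "('a, 'b) pre_digraph \<Rightarrow> 'a set set" where
  "undirected_edges \<Gamma> = (\<lambda>e. {tail \<Gamma> e, head \<Gamma> e}) ` arcs \<Gamma>"

definition cyclomatic_number :: "('a, 'b) pre_digraph \<Rightarrow> int" where
  "cyclomatic_number \<Gamma> = int (card (undirected_edges \<Gamma>)) - int (card (verts \<Gamma>)) + 1"

definition unicyclic :: "('a, 'b) pre_digraph \<Rightarrow> bool" where
  "unicyclic \<Gamma> \<longleftrightarrow> connected \<Gamma> \<and> cyclomatic_number \<Gamma> = 1"

definition bicyclic :: "('a, 'b) pre_digraph \<Rightarrow> bool" where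
  "bicyclic \<Gamma> \<longleftrightarrow> connected \<Gamma> \<and> cyclomatic_number \<Gamma> = 2"

definition tricyclic :: "('a, 'b) pre_digraph \<Rightarrow> bool" where
  "tricyclic \<Gamma> \<longleftrightarrow> connected \<Gamma> \<and> cyclomatic_number \<Gamma> = 3"

definition tetracyclic :: "('a, 'b) pre_digraph \<Rightarrow> bool" where
  "tetracyclic \<Gamma> \<longleftrightarrow> connected \<Gamma> \<and> cyclomatic_number \<Gamma> = 4"

definition pentacyclic :: "('a, 'b) pre_digraph \<Rightarrow> bool" where
  "pentacyclic \<Gamma> \<longleftrightarrow> connected \<Gamma> \<and> cyclomatic_number \<Gamma> = 5"

end

theory Submission
  imports Defs
begin

text \<open>
  Write \<open>n\<close> for the order of the finite non-cyclic group \<open>G\<close> and \<open>c\<close> for the cyclomatic number of the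
  complement graph on its non-isolated vertices. By the handshake identity, \<open>2(c - 1)\<close> is the sum of
  \<open>deg x - 2\<close> over these vertices (\<open>cyclomatic_eq_degree_sum\<close>). No summand is negative, because
  together with \<open>y\<close> also \<open>xy\<close> is a neighbour of \<open>x\<close>.

  A generator of a maximal cyclic subgroup \<open>M\<close> has degree \<open>n - |M|\<close>, which is at least \<open>n / 2\<close>. Summing
  over the generators of one such \<open>M\<close> gives at least \<open>n - 4\<close> (\<open>maximal_cyclic_contribution\<close>). A
  non-cyclic group is covered by its maximal cyclic subgroups and is never the union of two proper
  subgroups, so there are at least three of them. Hence \<open>3(n - 4) \<le> 2(c - 1)\<close>
  (\<open>cyclomatic_lower_bound\<close>), and \<open>c \<le> 5\<close> forces \<open>n \<le> 6\<close>. Groups of order 1, 2, 3 and 5 are cyclic,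
  which leaves \<open>n = 4\<close> and \<open>n = 6\<close>.

  Both remaining orders have the form \<open>2p\<close> with \<open>p\<close> prime. In a non-cyclic group of order \<open>2p\<close> all
  elements outside a suitable subgroup of order \<open>p\<close> are involutions. This makes the group dihedral
  and so unique up to isomorphism (\<open>iso_if_noncyclic_order_two_times_prime\<close>), and it gives
  \<open>2(c - 1) = (p - 2)(3p - 1)\<close>, together with connectedness
  (\<open>complement_graph_of_order_two_times_prime\<close>). So \<open>c = 1\<close> exactly for order 4, which is
  \<open>\<int>\<^sub>2 \<times> \<int>\<^sub>2\<close>, and \<open>c = 5\<close> exactly for order 6, which is \<open>S\<^sub>3\<close>; the values 2, 3 and 4 do not occur.
\<close>

section \<open>Edges and connectedness of simple graphs\<close>

text \<open>
  Each fibre of the map from arcs to undirected edges is a pair of opposite arcs, so counting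
  arcs by their tails counts every edge twice.
\<close>

lemma handshake:
  assumes "finite V" and sym: "\<And>x y. adj x y \<Longrightarrow> adj y x"
  shows "2 * card (undirected_edges (simple_graph_on V adj)) =
           (\<Sum>x\<in>V. card {y \<in> V. x \<noteq> y \<and> adj x y})"
proof -
  let ?A = "SIGMA x:V. {y \<in> V. x \<noteq> y \<and> adj x y}"
  let ?g = "\<lambda>e. {fst e, snd e}"
  have edges: "undirected_edges (simple_graph_on V adj) = ?g ` ?A"
    unfolding undirected_edges_def simple_graph_on_def by (auto intro!: image_cong)
  have finA: "finite ?A" using assms(1) by auto
  have fibre: "card {a \<in> ?A. ?g a = e} = 2" if "e \<in> ?g ` ?A" for e
  proof -
    obtain x y where xy: "x \<in> V" "y \<in> V" "x \<noteq> y" "adj x y" and e: "e = {x, y}"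
      using \<open>e \<in> ?g ` ?A\<close> by auto
    have "{a \<in> ?A. ?g a = e} = {(x, y), (y, x)}"
      using xy sym[OF xy(4)] by (auto simp: e doubleton_eq_iff)
    then show ?thesis using xy(3) by simp
  qed
  have "card ?A = (\<Sum>e\<in>?g ` ?A. card {a \<in> ?A. ?g a = e})"
    using sum.image_gen[OF finA, of "\<lambda>_. 1::nat" ?g] by simp
  also have "\<dots> = (\<Sum>e\<in>?g ` ?A. 2)" using fibre by (intro sum.cong) auto
  finally have "card ?A = 2 * card (?g ` ?A)" by simp
  moreover have "card ?A = (\<Sum>x\<in>V. card {y \<in> V. x \<noteq> y \<and> adj x y})"
    using assms(1) by (intro card_SigmaI) auto
  ultimately show ?thesis unfolding edges by simp
qed

lemma connected_if_universal_vertex: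
  assumes sym: "\<And>x y. adj x y \<Longrightarrow> adj y x"
    and b: "b \<in> V" "\<And>x. x \<in> V \<Longrightarrow> x \<noteq> b \<Longrightarrow> adj b x"
  shows "connected (simple_graph_on V adj)"
proof -
  let ?\<Gamma> = "simple_graph_on V adj"
  interpret wf_digraph ?\<Gamma>
    by unfold_locales (auto simp: simple_graph_on_def)
  have ends: "arcs_ends ?\<Gamma> = {(x, y). x \<in> V \<and> y \<in> V \<and> x \<noteq> y \<and> adj x y}"
    by (auto simp: arcs_ends_conv simple_graph_on_def image_iff)
  have symG: "symmetric ?\<Gamma>"
    unfolding symmetric_def ends by (rule symI) (auto intro: sym)
  have V: "verts ?\<Gamma> = V" by (simp add: simple_graph_on_def)
  have to_b: "x \<rightarrow>\<^sup>*\<^bsub>?\<Gamma>\<^esub> b" and from_b: "b \<rightarrow>\<^sup>*\<^bsub>?\<Gamma>\<^esub> x" if "x \<in> V" for x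
  proof -
    have "x \<rightarrow>\<^sup>*\<^bsub>?\<Gamma>\<^esub> b \<and> b \<rightarrow>\<^sup>*\<^bsub>?\<Gamma>\<^esub> x"
    proof (cases "x = b")
      case True then show ?thesis using b(1) V by auto
    next
      case False
      then have "x \<rightarrow>\<^bsub>?\<Gamma>\<^esub> b" "b \<rightarrow>\<^bsub>?\<Gamma>\<^esub> x" using that b sym unfolding ends by auto
      then show ?thesis by auto
    qed
    then show "x \<rightarrow>\<^sup>*\<^bsub>?\<Gamma>\<^esub> b" "b \<rightarrow>\<^sup>*\<^bsub>?\<Gamma>\<^esub> x" by auto
  qed
  have "u \<rightarrow>\<^sup>*\<^bsub>?\<Gamma>\<^esub> v" if "u \<in> V" "v \<in> V" for u v
    using to_b[OF that(1)] from_b[OF that(2)] by (rule reachable_trans)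
  then show ?thesis
    unfolding connected_def strongly_connected_def reachable_mk_symmetric_eq[OF symG]
    using b(1) V by auto
qed

section \<open>The complement of the enhanced power graph\<close>

text \<open>
  For a non-isolated vertex \<open>x\<close> this is exactly the neighbourhood of \<open>x\<close> in the complement graph;
  it never contains \<open>x\<close>, which lies in \<open>\<langle>x\<rangle>\<close>.
\<close>

definition noncocyclic :: "('a, 'm) monoid_scheme \<Rightarrow> 'a \<Rightarrow> 'a set" where
  "noncocyclic G x =
     {y \<in> carrier G. \<forall>z \<in> carrier G. \<not> (x \<in> generate G {z} \<and> y \<in> generate G {z})}"

text \<open>
  The elements that lie in a common cyclic subgroup with every other element form the
  cyclicizer of the group. They are the isolated vertices of the complement graph.
\<close>

definition outside_cyclicizer :: "('a, 'm) monoid_scheme \<Rightarrow> 'a set" where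
  "outside_cyclicizer G = {x \<in> carrier G. noncocyclic G x \<noteq> {}}"

lemma noncocyclic_sym:
  "x \<in> carrier G \<Longrightarrow> y \<in> noncocyclic G x \<Longrightarrow> x \<in> noncocyclic G y"
  by (auto simp: noncocyclic_def)

lemma noncocyclic_subset: "x \<in> carrier G \<Longrightarrow> noncocyclic G x \<subseteq> outside_cyclicizer G"
proof
  fix y assume x: "x \<in> carrier G" and y: "y \<in> noncocyclic G x"
  have "x \<in> noncocyclic G y" using noncocyclic_sym x y .
  moreover have "y \<in> carrier G" using y by (simp add: noncocyclic_def)
  ultimately show "y \<in> outside_cyclicizer G" unfolding outside_cyclicizer_def by blast
qed

lemma (in group) not_noncocyclic_self: "x \<in> carrier G \<Longrightarrow> x \<notin> noncocyclic G x"
  by (auto simp: noncocyclic_def intro: generate.incl)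

text \<open>
  Reduces the graph, which is built from an enhanced power graph by complementation and
  restriction, to a single explicit adjacency relation, so that the group theory below
  never mentions arcs.
\<close>

lemma (in group) complement_graph_eq:
  "proper_enhanced_power_graph_complement G =
     simple_graph_on (outside_cyclicizer G)
       (\<lambda>x y. \<forall>z \<in> carrier G. \<not> (x \<in> generate G {z} \<and> y \<in> generate G {z}))"
proof -
  let ?\<Delta> = "graph_complement (enhanced_power_graph G)"
  let ?A = "{(x, y). x \<in> carrier G \<and> y \<in> noncocyclic G x}"
  have E: "arcs_ends (enhanced_power_graph G) =
      {(x, y). x \<in> carrier G \<and> y \<in> carrier G \<and> x \<noteq> y \<and>
         (\<exists>z \<in> carrier G. x \<in> generate G {z} \<and> y \<in> generate G {z})}"
    by (auto simp: arcs_ends_conv enhanced_power_graph_def simple_graph_on_def image_iff)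
  have verts_E: "verts (enhanced_power_graph G) = carrier G"
    by (simp add: enhanced_power_graph_def simple_graph_on_def)
  have D: "?\<Delta> = \<lparr>verts = carrier G, arcs = ?A, tail = fst, head = snd\<rparr>"
    using not_noncocyclic_self
    unfolding graph_complement_def E verts_E by (auto simp: simple_graph_on_def noncocyclic_def)
  have ends: "arcs_ends ?\<Delta> = ?A" by (auto simp: arcs_ends_conv D image_iff)
  have N: "non_isolated_verts ?\<Delta> = outside_cyclicizer G"
    unfolding non_isolated_verts_def ends outside_cyclicizer_def
    by (auto simp: D noncocyclic_def)
  have arcs: "{e \<in> ?A. fst e \<in> outside_cyclicizer G \<and> snd e \<in> outside_cyclicizer G} =
     {(x, y). x \<in> outside_cyclicizer G \<and> y \<in> outside_cyclicizer G \<and> x \<noteq> y \<and>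
         (\<forall>z \<in> carrier G. \<not> (x \<in> generate G {z} \<and> y \<in> generate G {z}))}"
    using not_noncocyclic_self by (auto simp: outside_cyclicizer_def noncocyclic_def)
  show ?thesis
    unfolding proper_enhanced_power_graph_complement_def Let_def N
    unfolding D induce_subgraph_def simple_graph_on_def using arcs by simp
qed

abbreviation complement_cyclomatic :: "('a, 'm) monoid_scheme \<Rightarrow> int" where
  "complement_cyclomatic G \<equiv> cyclomatic_number (proper_enhanced_power_graph_complement G)"

text \<open>
  By the handshake identity, twice the number of edges minus twice the number of vertices is
  the sum of \<open>deg x - 2\<close> over all vertices.
  In this form the cyclomatic number can be bounded one vertex at a time.
\<close>

lemma (in group) cyclomatic_eq_degree_sum:
  assumes fin: "finite (carrier G)"
  shows "2 * (complement_cyclomatic G - 1) =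
           (\<Sum>x\<in>outside_cyclicizer G. int (card (noncocyclic G x)) - 2)"
proof -
  let ?V = "outside_cyclicizer G"
  let ?adj = "\<lambda>x y. \<forall>z \<in> carrier G. \<not> (x \<in> generate G {z} \<and> y \<in> generate G {z})"
  have sub: "?V \<subseteq> carrier G" by (auto simp: outside_cyclicizer_def)
  then have finV: "finite ?V" using fin finite_subset by blast
  have nbrs: "{y \<in> ?V. x \<noteq> y \<and> ?adj x y} = noncocyclic G x" if "x \<in> ?V" for x
    using noncocyclic_subset[of x G] not_noncocyclic_self that sub
    by (auto simp: noncocyclic_def)
  have "2 * card (undirected_edges (simple_graph_on ?V ?adj)) =
          (\<Sum>x\<in>?V. card {y \<in> ?V. x \<noteq> y \<and> ?adj x y})"
    using finV by (rule handshake) blast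
  also have "\<dots> = (\<Sum>x\<in>?V. card (noncocyclic G x))"
    using nbrs by (intro sum.cong) auto
  finally have count: "2 * card (undirected_edges (simple_graph_on ?V ?adj)) =
     (\<Sum>x\<in>?V. card (noncocyclic G x))" .
  have "2 * int (card (undirected_edges (simple_graph_on ?V ?adj))) =
     int (2 * card (undirected_edges (simple_graph_on ?V ?adj)))" by simp
  also have "\<dots> = (\<Sum>x\<in>?V. int (card (noncocyclic G x)))" unfolding count by simp
  finally have "2 * int (card (undirected_edges (simple_graph_on ?V ?adj))) =
     (\<Sum>x\<in>?V. int (card (noncocyclic G x)))" .
  then show ?thesis
    unfolding cyclomatic_number_def complement_graph_eq
    by (simp add: sum_subtractf simple_graph_on_def)
qed

section \<open>Maximal cyclic subgroups bound the cyclomatic number\<close>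

context group begin

lemma cyclic_if_generated_by_element:
  assumes "x \<in> carrier G" "generate G {x} = carrier G"
  shows "cyclic_group G"
proof -
  have "carrier G = range (\<lambda>n::int. x [^] n)"
    using assms(2) generate_pow[OF assms(1)] by (simp add: full_SetCompr_eq)
  then show ?thesis using assms(1) unfolding cyclic_group by blast
qed

lemma generate_subset_carrier: "x \<in> carrier G \<Longrightarrow> generate G {x} \<subseteq> carrier G"
  using generate_incl by auto

lemma generate_subset_iff:
  assumes "x \<in> carrier G" "z \<in> carrier G"
  shows "generate G {x} \<subseteq> generate G {z} \<longleftrightarrow> x \<in> generate G {z}"
proof
  assume "x \<in> generate G {z}"
  then show "generate G {x} \<subseteq> generate G {z}"
    using generate_subgroup_incl generate_is_subgroup assms by simp
next
  assume "generate G {x} \<subseteq> generate G {z}"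
  then show "x \<in> generate G {z}" using generate.incl[of x "{x}" G] by auto
qed

text \<open>
  The predicate concerns a generator rather than the subgroup, because generators are the
  vertices whose degrees are known.
\<close>

definition maximal_cyclic :: "'a \<Rightarrow> bool" where
  "maximal_cyclic x \<longleftrightarrow>
     x \<in> carrier G \<and> (\<forall>z \<in> carrier G. x \<in> generate G {z} \<longrightarrow> generate G {z} = generate G {x})"

lemma exists_maximal_cyclic:
  assumes fin: "finite (carrier G)" and y: "y \<in> carrier G"
  obtains x where "maximal_cyclic x" "y \<in> generate G {x}"
proof -
  let ?S = "{x \<in> carrier G. y \<in> generate G {x}}"
  let ?f = "\<lambda>x. card (generate G {x})"
  have "y \<in> ?S" using y generate.incl[of y "{y}" G] by auto
  moreover have "finite ?S" using fin by simp
  ultimately have "Max (?f ` ?S) \<in> ?f ` ?S" by (intro Max_in) auto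
  then obtain x where x: "x \<in> ?S" "?f x = Max (?f ` ?S)" by auto
  have max: "?f z \<le> ?f x" if "z \<in> ?S" for z
    unfolding x(2) using that fin by (intro Max_ge) auto
  have "generate G {z} = generate G {x}" if z: "z \<in> carrier G" "x \<in> generate G {z}" for z
  proof -
    have sub: "generate G {x} \<subseteq> generate G {z}" using z x generate_subset_iff by auto
    then have "z \<in> ?S" using z x by auto
    moreover have "finite (generate G {z})"
      using fin generate_subset_carrier z(1) finite_subset by blast
    ultimately show ?thesis using sub max card_seteq[of "generate G {z}"] by auto
  qed
  then have "maximal_cyclic x" using x unfolding maximal_cyclic_def by auto
  then show thesis using that x by auto
qed

text \<open>
  The only cyclic subgroup containing \<open>x\<close> is \<open>\<langle>x\<rangle>\<close> itself, so \<open>x\<close> is adjacent to everything outside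
  it and its degree is \<open>|G| - |\<langle>x\<rangle>|\<close>.
\<close>

lemma noncocyclic_of_maximal:
  assumes "maximal_cyclic x"
  shows "noncocyclic G x = carrier G - generate G {x}"
  using assms generate.incl[of x "{x}" G] unfolding maximal_cyclic_def noncocyclic_def by auto

text \<open>
  If \<open>y\<close> is a neighbour of \<open>x\<close>, then so is \<open>xy\<close>, since a cyclic subgroup containing \<open>x\<close> and \<open>xy\<close>
  contains \<open>y\<close>. Hence no summand \<open>deg x - 2\<close> is negative, and summands may be discarded in a
  lower bound.
\<close>

lemma two_le_card_noncocyclic:
  assumes fin: "finite (carrier G)" and x: "x \<in> outside_cyclicizer G"
  shows "2 \<le> card (noncocyclic G x)"
proof -
  have xG: "x \<in> carrier G" using x by (auto simp: outside_cyclicizer_def)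
  obtain y where y: "y \<in> noncocyclic G x" using x by (auto simp: outside_cyclicizer_def)
  then have yG: "y \<in> carrier G" by (auto simp: noncocyclic_def)
  have xy: "x \<otimes> y \<in> noncocyclic G x"
  proof -
    have "y \<in> generate G {z}" if z: "z \<in> carrier G" "x \<in> generate G {z}" "x \<otimes> y \<in> generate G {z}" for z
    proof -
      have sg: "subgroup (generate G {z}) G" using z(1) generate_is_subgroup by simp
      have "inv x \<otimes> (x \<otimes> y) \<in> generate G {z}"
        using sg z by (simp add: subgroup.m_closed subgroup.m_inv_closed)
      then show ?thesis using xG yG by (simp add: m_assoc[symmetric])
    qed
    then show ?thesis using y xG yG by (auto simp: noncocyclic_def)
  qed
  have "x \<noteq> \<one>" using y by (auto simp: noncocyclic_def intro: generate.intros)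
  then have "x \<otimes> y \<noteq> y" using xG yG by simp
  then have "card {y, x \<otimes> y} = 2" by auto
  moreover have "finite (noncocyclic G x)" using fin by (auto simp: noncocyclic_def)
  ultimately show ?thesis using xy y card_mono[of "noncocyclic G x" "{y, x \<otimes> y}"] by auto
qed

definition cyclic_gens :: "'a \<Rightarrow> 'a set" where
  "cyclic_gens x = {z \<in> carrier G. generate G {z} = generate G {x}}"

text \<open>
  Let \<open>k\<close> be the order of a maximal cyclic subgroup. It has \<open>\<phi>(k)\<close> generators, each contributing
  \<open>|G| - k - 2\<close>. If \<open>k = 2\<close>, one generator already gives \<open>|G| - 4\<close>. If \<open>k > 2\<close>, then \<open>x\<close> and its
  inverse are two distinct generators, and \<open>k \<le> |G| / 2\<close> by Lagrange, so together they give at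
  least \<open>2(|G| / 2 - 2) = |G| - 4\<close>.
\<close>

lemma maximal_cyclic_contribution:
  assumes fin: "finite (carrier G)" and nc: "\<not> cyclic_group G" and x: "maximal_cyclic x"
  shows "cyclic_gens x \<subseteq> outside_cyclicizer G"
    and "int (order G) - 4 \<le> (\<Sum>z\<in>cyclic_gens x. int (card (noncocyclic G z)) - 2)"
proof -
  let ?M = "generate G {x}"
  have xG: "x \<in> carrier G" using x by (simp add: maximal_cyclic_def)
  have MG: "?M \<subseteq> carrier G" using generate_subset_carrier xG .
  have sg: "subgroup ?M G" using xG generate_is_subgroup by simp
  have proper: "?M \<noteq> carrier G" using nc cyclic_if_generated_by_element xG by blast
  have max: "maximal_cyclic z" if "z \<in> cyclic_gens x" for z
    using that x generate_subset_iff unfolding cyclic_gens_def maximal_cyclic_def by blast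
  have nbrs: "noncocyclic G z = carrier G - ?M" if "z \<in> cyclic_gens x" for z
    using noncocyclic_of_maximal[OF max[OF that]] that by (simp add: cyclic_gens_def)
  show "cyclic_gens x \<subseteq> outside_cyclicizer G"
    using nbrs proper MG by (auto simp: outside_cyclicizer_def cyclic_gens_def)
  obtain k where k: "order G = card ?M * k" 
    using lagrange[OF sg] by (metis mult.commute)
  have "card ?M < order G"
    using proper MG fin unfolding order_def by (simp add: psubset_card_mono psubset_eq)
  then have "k \<noteq> 0" "k \<noteq> 1" using k by auto
  then have "2 \<le> k" by simp
  then have half: "2 * card ?M \<le> order G" using k by (simp add: mult.commute)
  \<comment> \<open>If the trivial subgroup were maximal cyclic, the group would be trivial, hence cyclic.\<close>
  have nontriv: "x \<noteq> \<one>"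
  proof
    assume "x = \<one>"
    then have "generate G {z} = {\<one>}" if "z \<in> carrier G" for z
      using x that generate.one generate_one unfolding maximal_cyclic_def by metis
    then have "carrier G = {\<one>}" using generate.incl by fastforce
    then show False using proper \<open>x = \<one>\<close> generate_one by simp
  qed
  have ordM: "ord x = card ?M" using generate_pow_card xG .
  have finM: "finite ?M" using MG fin finite_subset by blast
  have M2: "2 \<le> card ?M"
  proof -
    have "card {\<one>, x} \<le> card ?M"
      using finM generate.one generate.incl by (intro card_mono) (auto intro: generate.intros)
    then show ?thesis using nontriv by simp
  qed
  have fing: "finite (cyclic_gens x)" using fin by (simp add: cyclic_gens_def)
  have card_nbrs: "int (card (carrier G - ?M)) = int (order G) - int (card ?M)"
    using MG fin by (simp add: card_Diff_subset finM order_def card_mono of_nat_diff)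
  have sum: "(\<Sum>z\<in>cyclic_gens x. int (card (noncocyclic G z)) - 2) =
      int (card (cyclic_gens x)) * (int (order G) - int (card ?M) - 2)"
    using nbrs card_nbrs by simp
  have x_gen: "x \<in> cyclic_gens x" using xG by (simp add: cyclic_gens_def)
  show "int (order G) - 4 \<le> (\<Sum>z\<in>cyclic_gens x. int (card (noncocyclic G z)) - 2)"
  proof (cases "card ?M = 2")
    case True
    have "1 \<le> card (cyclic_gens x)" using x_gen fing by (metis One_nat_def Suc_leI card_gt_0_iff empty_iff)
    moreover have "4 \<le> order G" using half True by simp
    ultimately show ?thesis
      using mult_right_mono[of 1 "int (card (cyclic_gens x))" "int (order G) - 4"]
      unfolding sum True by simp
  next
    case False
    have "inv x \<in> ?M" using sg generate.incl[of x "{x}" G] by (simp add: subgroup.m_inv_closed)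
    moreover have "x \<in> generate G {inv x}" 
      using xG generate_m_inv_closed[of "{inv x}" "inv x"] generate.incl[of "inv x" "{inv x}" G] by simp
    ultimately have inv_gen: "inv x \<in> cyclic_gens x"
      using xG generate_subset_iff unfolding cyclic_gens_def by blast
    have "inv x \<noteq> x"
    proof
      assume "inv x = x"
      then have "x [^] (2::nat) = \<one>" using r_inv[OF xG] xG by (simp add: numeral_2_eq_2)
      then have "ord x dvd 2" using xG pow_eq_id by blast
      then show False using False M2 ordM dvd_imp_le[of "ord x" 2] by simp
    qed
    then have "2 \<le> card (cyclic_gens x)"
      using card_mono[OF fing, of "{x, inv x}"] x_gen inv_gen by auto
    moreover have "0 \<le> int (order G) - int (card ?M) - 2" using half M2 False by linarith
    moreover have "int (order G) - 4 \<le> 2 * (int (order G) - int (card ?M) - 2)"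
      using half by presburger
    moreover have "2 * (int (order G) - int (card ?M) - 2) \<le>
        int (card (cyclic_gens x)) * (int (order G) - int (card ?M) - 2)"
      using calculation(1,2) by (intro mult_right_mono) auto
    ultimately show ?thesis unfolding sum by (meson order_trans)
  qed
qed

text \<open>
  A group is not the union of two proper subgroups: if \<open>x\<close> and \<open>y\<close> generate two distinct maximal
  cyclic subgroups, then \<open>xy\<close> lies in neither of them, and it lies in some third one.
\<close>

lemma three_maximal_cyclic:
  assumes fin: "finite (carrier G)" and nc: "\<not> cyclic_group G"
  obtains x y w where "maximal_cyclic x" "maximal_cyclic y" "maximal_cyclic w"
    "generate G {x} \<noteq> generate G {y}" "generate G {x} \<noteq> generate G {w}"
    "generate G {y} \<noteq> generate G {w}"
proof -
  obtain x where x: "maximal_cyclic x" using exists_maximal_cyclic[OF fin one_closed] by blast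
  then have xG: "x \<in> carrier G" by (simp add: maximal_cyclic_def)
  have "generate G {x} \<noteq> carrier G" using nc cyclic_if_generated_by_element xG by blast
  then obtain u where u: "u \<in> carrier G" "u \<notin> generate G {x}"
    using generate_subset_carrier xG by blast
  obtain y where y: "maximal_cyclic y" "u \<in> generate G {y}" using exists_maximal_cyclic[OF fin u(1)] .
  then have yG: "y \<in> carrier G" by (simp add: maximal_cyclic_def)
  have neq: "generate G {x} \<noteq> generate G {y}" using u y by auto
  have x_y: "x \<notin> generate G {y}" using x neq yG by (auto simp: maximal_cyclic_def)
  have y_x: "y \<notin> generate G {x}" using y neq xG by (auto simp: maximal_cyclic_def)
  have sgx: "subgroup (generate G {x}) G" and sgy: "subgroup (generate G {y}) G"
    using generate_is_subgroup xG yG by auto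
  have xx: "x \<in> generate G {x}" and yy: "y \<in> generate G {y}" by (auto intro: generate.incl)
  have "x \<otimes> y \<notin> generate G {x}"
    using y_x subgroup.m_closed[OF sgx subgroup.m_inv_closed[OF sgx xx], of "x \<otimes> y"] xG yG
    by (auto simp: m_assoc[symmetric])
  moreover have "x \<otimes> y \<notin> generate G {y}"
    using x_y subgroup.m_closed[OF sgy _ subgroup.m_inv_closed[OF sgy yy], of "x \<otimes> y"] xG yG
    by (auto simp: m_assoc)
  moreover obtain w where "maximal_cyclic w" "x \<otimes> y \<in> generate G {w}"
    using exists_maximal_cyclic[OF fin m_closed[OF xG yG]] .
  ultimately show ?thesis using that[OF x y(1)] neq by metis
qed

text \<open>
  Distinct cyclic subgroups have disjoint sets of generators, so the contributions of three
  maximal ones add up.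
\<close>

theorem cyclomatic_lower_bound:
  assumes fin: "finite (carrier G)" and nc: "\<not> cyclic_group G"
  shows "3 * (int (order G) - 4) \<le> 2 * (complement_cyclomatic G - 1)"
proof -
  obtain x y w where max: "maximal_cyclic x" "maximal_cyclic y" "maximal_cyclic w"
    and neq: "generate G {x} \<noteq> generate G {y}" "generate G {x} \<noteq> generate G {w}"
    "generate G {y} \<noteq> generate G {w}"
    using three_maximal_cyclic[OF fin nc] .
  let ?f = "\<lambda>z. int (card (noncocyclic G z)) - 2"
  let ?S = "cyclic_gens x \<union> cyclic_gens y \<union> cyclic_gens w"
  note c = maximal_cyclic_contribution[OF fin nc]
  have fg: "finite (cyclic_gens z)" for z using fin by (simp add: cyclic_gens_def)
  have disj: "cyclic_gens x \<inter> cyclic_gens y = {}"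
    "(cyclic_gens x \<union> cyclic_gens y) \<inter> cyclic_gens w = {}"
    using neq by (auto simp: cyclic_gens_def)
  have "sum ?f ?S = sum ?f (cyclic_gens x) + sum ?f (cyclic_gens y) + sum ?f (cyclic_gens w)"
    using fg disj by (simp add: sum.union_disjoint)
  moreover have "3 * n \<le> r + s + t" if "n \<le> r" "n \<le> s" "n \<le> t" for n r s t :: int
    using that by presburger
  ultimately have "3 * (int (order G) - 4) \<le> sum ?f ?S"
    using c(2)[OF max(1)] c(2)[OF max(2)] c(2)[OF max(3)] by simp
  also have "\<dots> \<le> sum ?f (outside_cyclicizer G)"
  proof (rule sum_mono2)
    show "finite (outside_cyclicizer G)" using fin by (simp add: outside_cyclicizer_def)
    show "?S \<subseteq> outside_cyclicizer G" using c(1) max by blast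
    show "0 \<le> ?f z" if "z \<in> outside_cyclicizer G - ?S" for z
      using two_le_card_noncocyclic[OF fin, of z] that by simp
  qed
  finally show ?thesis using cyclomatic_eq_degree_sum[OF fin] by simp
qed

end

section \<open>Non-cyclic groups of order twice a prime\<close>

context group begin

text \<open>
  The complement of a subgroup \<open>H\<close> of index two is the single coset \<open>(inv x) H\<close>; it contains \<open>y\<close>, hence
  \<open>xy \<in> H\<close>.
\<close>

lemma mult_of_nonmembers_index_two:
  assumes H: "subgroup H G" and fin: "finite (carrier G)" and idx: "order G = 2 * card H"
    and x: "x \<in> carrier G" "x \<notin> H" and y: "y \<in> carrier G" "y \<notin> H"
  shows "x \<otimes> y \<in> H"
proof -
  have HG: "H \<subseteq> carrier G" using subgroup.subset[OF H] .
  let ?C = "(\<lambda>h. inv x \<otimes> h) ` H"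
  have CG: "?C \<subseteq> carrier G - H"
  proof -
    have "inv x \<otimes> h \<notin> H" if h: "h \<in> H" for h
    proof
      assume "inv x \<otimes> h \<in> H"
      then have "(inv x \<otimes> h) \<otimes> inv h \<in> H" using H h by (simp add: subgroup.m_closed subgroup.m_inv_closed)
      then have "inv x \<in> H" using x(1) h HG by (simp add: m_assoc subsetD)
      then have "inv (inv x) \<in> H" using H by (rule subgroup.m_inv_closed[rotated])
      then show False using x by simp
    qed
    then show ?thesis using HG x(1) by auto
  qed
  have "inj_on (\<lambda>h. inv x \<otimes> h) H" using HG x(1) by (auto simp: inj_on_def subset_iff)
  then have "card ?C = card H" by (rule card_image)
  moreover have "card (carrier G - H) = card H"
    using idx HG fin finite_subset unfolding order_def by (subst card_Diff_subset) auto
  ultimately have "?C = carrier G - H" using CG fin by (intro card_subset_eq) auto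
  then obtain h where "h \<in> H" "y = inv x \<otimes> h" using y by blast
  then show ?thesis using x(1) HG by (auto simp: m_assoc[symmetric])
qed

lemma order_two_mult_self: "x \<in> carrier G \<Longrightarrow> ord x = 2 \<Longrightarrow> x \<otimes> x = \<one>"
  using pow_ord_eq_1[of x] by (simp add: numeral_2_eq_2)

text \<open>
  A Sylow argument provides a subgroup of order \<open>p\<close>, generated by some \<open>a\<close>. An element \<open>x\<close> outside
  has order 2 or \<open>p\<close>, as order \<open>2p\<close> would make the group cyclic. Order \<open>p\<close> with \<open>p\<close> odd is
  impossible: \<open>x\<^sup>2\<close> lies in the index-two subgroup \<open>\<langle>a\<rangle>\<close>, and \<open>x\<close> is a power of \<open>x\<^sup>2\<close>. This one
  fact determines both the isomorphism type of the group and the complement graph.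
\<close>

lemma involutions_outside_cyclic_subgroup:
  assumes fin: "finite (carrier G)" and nc: "\<not> cyclic_group G"
    and p: "Factorial_Ring.prime p" and ordG: "order G = 2 * p"
  obtains a where "a \<in> carrier G" "ord a = p"
    "\<And>x. x \<in> carrier G \<Longrightarrow> x \<notin> generate G {a} \<Longrightarrow> ord x = 2"
proof -
  obtain H where H: "subgroup H G" "card H = p"
    using sylow_thm[OF p is_group, of 1 2] ordG fin by (auto simp: mult.commute)
  have HG: "H \<subseteq> carrier G" using subgroup.subset[OF H(1)] .
  have "1 < p" using p prime_gt_1_nat by blast
  then have "H \<noteq> {\<one>}" using H(2) by auto
  then obtain a where a: "a \<in> H" "a \<noteq> \<one>" using subgroup.one_closed[OF H(1)] by blast
  then have aG: "a \<in> carrier G" using HG by auto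
  have ord_a: "ord a = p"
  proof -
    interpret HH: group "G\<lparr>carrier := H\<rparr>" using subgroup_imp_group[OF H(1)] .
    have "a [^] p = \<one>"
      using HH.pow_order_eq_1[of a] a(1) H(2) by (simp add: order_def nat_pow_consistent[symmetric])
    then have "ord a dvd p" using pow_eq_id aG by blast
    moreover have "ord a \<noteq> 1" using a(2) ord_eq_1[OF aG] by simp
    ultimately show ?thesis using p by (auto simp: prime_nat_iff)
  qed
  have card_a: "card (generate G {a}) = p" using generate_pow_card[OF aG] ord_a by simp
  have sg: "subgroup (generate G {a}) G" using aG generate_is_subgroup by simp
  have "ord x = 2" if x: "x \<in> carrier G" "x \<notin> generate G {a}" for x
  proof -
    have sq: "x [^] (2::nat) \<in> generate G {a}"
      using mult_of_nonmembers_index_two[OF sg fin _ x x] card_a ordG x(1) by (simp add: numeral_2_eq_2)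
    have not1: "ord x \<noteq> 1" using x(2) ord_eq_1[OF x(1)] generate.one[of G "{a}"] by auto
    have not_full: "ord x \<noteq> 2 * p"
    proof
      assume "ord x = 2 * p"
      then have "generate G {x} = carrier G"
        using generate_pow_card[OF x(1)] generate_subset_carrier[OF x(1)] fin ordG
        by (intro card_subset_eq) (auto simp: order_def)
      then show False using nc cyclic_if_generated_by_element x(1) by blast
    qed
    have "ord x = p \<Longrightarrow> p = 2"
    proof (rule ccontr)
      assume "ord x = p" "p \<noteq> 2"
      then have "2 < p" using \<open>1 < p\<close> by simp
      then have "odd p" using p prime_odd_nat by blast
      then obtain k where k: "p = 2 * k + 1" by (auto elim: oddE)
      \<comment> \<open>As \<open>p + 1\<close> is even, \<open>x = x\<^bsup>p + 1\<^esup>\<close> is a power of the square of \<open>x\<close>.\<close>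
      have "x = x [^] (p + 1)"
        using x(1) \<open>ord x = p\<close> pow_ord_eq_1[OF x(1)] by simp
      also have "\<dots> = (x [^] (2::nat)) [^] (k + 1)" using x(1) k by (simp only: nat_pow_pow) simp
      also have "\<dots> \<in> generate G {a}"
        using subgroup_int_pow_closed[OF sg sq, of "int (k + 1)"] by (simp only: int_pow_int)
      finally show False using x(2) by simp
    qed
    moreover have "ord x dvd 2 * p" using ord_dvd_group_order[OF x(1)] ordG by simp
    then obtain u v where "ord x = u * v" "u dvd 2" "v dvd p" by (rule dvd_productE)
    moreover have "u = 1 \<or> u = 2" "v = 1 \<or> v = p"
      using \<open>u dvd 2\<close> \<open>v dvd p\<close> p two_is_prime_nat by (auto simp: prime_nat_iff)
    ultimately show ?thesis using not1 not_full by auto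
  qed
  then show ?thesis using that aG ord_a by blast
qed

text \<open>
  The normal form \<open>a\<^sup>i b\<^sup>s\<close>. The exponent \<open>i\<close> is an integer, taken modulo the order of \<open>a\<close> only
  when elements are compared, so that the multiplication rule needs no reduction.
\<close>

definition dihedral_elem :: "'a \<Rightarrow> 'a \<Rightarrow> int \<times> bool \<Rightarrow> 'a" where
  "dihedral_elem a b u = a [^] fst u \<otimes> (if snd u then b else \<one>)"

text \<open>
  Every \<open>a\<^sup>i b\<close> with \<open>b\<close> outside \<open>\<langle>a\<rangle>\<close> is an involution, which forces \<open>b a\<^sup>i = (inv a)\<^sup>i b\<close>. The conclusion
  records the equality test and the multiplication table of the normal forms \<open>a\<^sup>i b\<^sup>s\<close>; both
  depend on \<open>p\<close> only.
\<close>

lemma dihedral_presentation: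
  assumes fin: "finite (carrier G)" and nc: "\<not> cyclic_group G"
    and p: "Factorial_Ring.prime p" and ordG: "order G = 2 * p"
  obtains a b where "a \<in> carrier G" "b \<in> carrier G"
    "range (dihedral_elem a b) = carrier G"
    "\<And>i s k t. dihedral_elem a b (i, s) = dihedral_elem a b (k, t) \<longleftrightarrow> s = t \<and> int p dvd k - i"
    "\<And>i s k t. dihedral_elem a b (i, s) \<otimes> dihedral_elem a b (k, t) =
       dihedral_elem a b (if s then i - k else i + k, s \<noteq> t)"
proof -
  obtain a where a: "a \<in> carrier G" "ord a = p"
    and inv2: "\<And>x. x \<in> carrier G \<Longrightarrow> x \<notin> generate G {a} \<Longrightarrow> ord x = 2"
    by (rule involutions_outside_cyclic_subgroup[OF assms]) blast
  let ?A = "generate G {a}"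
  have sg: "subgroup ?A G" using a generate_is_subgroup by simp
  have card_a: "card ?A = p" using generate_pow_card a by simp
  have powA: "a [^] i \<in> ?A" for i :: int using generate_pow[OF a(1)] by blast
  have "?A \<noteq> carrier G" using nc cyclic_if_generated_by_element a(1) by blast
  then obtain b where b: "b \<in> carrier G" "b \<notin> ?A" using generate_subset_carrier[OF a(1)] by blast
  have pow_b_notin: "a [^] i \<otimes> b \<notin> ?A" for i :: int
  proof
    assume "a [^] i \<otimes> b \<in> ?A"
    then have "inv (a [^] i) \<otimes> (a [^] i \<otimes> b) \<in> ?A"
      using sg powA by (simp add: subgroup.m_closed subgroup.m_inv_closed)
    then show False using a b by (simp add: m_assoc[symmetric])
  qed
  have bb: "b \<otimes> b = \<one>" using order_two_mult_self inv2 b by blast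
  have comm: "b \<otimes> a [^] i = a [^] (- i) \<otimes> b" for i :: int
  proof -
    \<comment> \<open>The involution \<open>a\<^bsup>-i\<^esup> b\<close> equals its own inverse \<open>b a\<^bsup>i\<^esup>\<close>.\<close>
    have "ord (a [^] (- i) \<otimes> b) = 2" using inv2 pow_b_notin a b by simp
    then have "(a [^] (- i) \<otimes> b) \<otimes> (a [^] (- i) \<otimes> b) = \<one>" using order_two_mult_self a b by simp
    then have "a [^] (- i) \<otimes> b = inv (a [^] (- i) \<otimes> b)" using a b by (simp add: inv_equality)
    also have "\<dots> = inv b \<otimes> a [^] i" using a b by (simp add: inv_mult_group int_pow_neg)
    also have "inv b = b" using bb b by (simp add: inv_equality)
    finally show ?thesis by simp
  qed
  show thesis
  proof (rule that[OF a(1) b(1)])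
    show "range (dihedral_elem a b) = carrier G"
    proof
      show "range (dihedral_elem a b) \<subseteq> carrier G" using a b by (auto simp: dihedral_elem_def)
      show "carrier G \<subseteq> range (dihedral_elem a b)"
      proof
        fix x assume x: "x \<in> carrier G"
        show "x \<in> range (dihedral_elem a b)"
        proof (cases "x \<in> ?A")
          case True
          then obtain i :: int where "x = a [^] i" using generate_pow[OF a(1)] by blast
          then have "x = dihedral_elem a b (i, False)" using a by (simp add: dihedral_elem_def)
          then show ?thesis by blast
        next
          case False
          then have "x \<otimes> b \<in> ?A"
            using mult_of_nonmembers_index_two[OF sg fin _ x _ b] card_a ordG by simp
          then obtain i :: int where "x \<otimes> b = a [^] i" using generate_pow[OF a(1)] by blast
          then have "a [^] i \<otimes> b = x \<otimes> (b \<otimes> b)" using x b by (simp add: m_assoc[symmetric])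
          then have "x = dihedral_elem a b (i, True)" using x bb by (simp add: dihedral_elem_def)
          then show ?thesis by blast
        qed
      qed
    qed
  next
    fix i s k t
    show "dihedral_elem a b (i, s) = dihedral_elem a b (k, t) \<longleftrightarrow> s = t \<and> int p dvd k - i"
      using a b int_pow_eq[OF a(1), of i k] pow_b_notin[of i] pow_b_notin[of k] powA[of i] powA[of k]
      by (auto simp: dihedral_elem_def)
  next
    fix i k :: int and s t
    have "a [^] i \<otimes> b \<otimes> a [^] k = a [^] i \<otimes> (a [^] (- k) \<otimes> b)"
      using a b comm[of k] by (simp add: m_assoc)
    also have "\<dots> = (a [^] i \<otimes> a [^] (- k)) \<otimes> b" using a b by (simp add: m_assoc del: int_pow_neg)
    also have "a [^] i \<otimes> a [^] (- k) = a [^] (i - k)" using int_pow_mult[OF a(1), of i "- k"] by simp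
    finally have flip: "a [^] i \<otimes> b \<otimes> a [^] k = a [^] (i - k) \<otimes> b" .
    have "a [^] i \<otimes> b \<otimes> (a [^] k \<otimes> b) = (a [^] i \<otimes> b \<otimes> a [^] k) \<otimes> b"
      using a b by (simp add: m_assoc)
    also have "\<dots> = a [^] (i - k)" unfolding flip using a b bb by (simp add: m_assoc)
    finally have "a [^] i \<otimes> b \<otimes> (a [^] k \<otimes> b) = a [^] (i - k)" .
    moreover have "a [^] i \<otimes> (a [^] k \<otimes> c) = a [^] (i + k) \<otimes> c" if "c \<in> carrier G" for c
      using int_pow_mult[OF a(1), of i k] a that by (simp add: m_assoc[symmetric])
    moreover have "a [^] i \<otimes> a [^] k = a [^] (i + k)"
      using int_pow_mult[OF a(1), of i k] by simp
    ultimately show "dihedral_elem a b (i, s) \<otimes> dihedral_elem a b (k, t) =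
       dihedral_elem a b (if s then i - k else i + k, s \<noteq> t)"
      using a b flip by (cases s; cases t) (simp_all add: dihedral_elem_def)
  qed
qed

end

text \<open>
  Both groups are dihedral of order \<open>2p\<close> (the Klein four-group for \<open>p = 2\<close>). Matching normal forms
  is well defined and injective because equality of normal forms is decided by the same condition
  in both groups, and it is a homomorphism because the multiplication tables agree.
\<close>

lemma iso_if_noncyclic_order_two_times_prime:
  assumes G: "group G" "finite (carrier G)" "\<not> cyclic_group G" "order G = 2 * p"
    and H: "group H" "finite (carrier H)" "\<not> cyclic_group H" "order H = 2 * p"
    and p: "Factorial_Ring.prime p"
  shows "G \<cong> H"
proof -
  let ?d = "group.dihedral_elem G" and ?e = "group.dihedral_elem H"
  obtain a b where ab: "range (?d a b) = carrier G"
    "\<And>i s k t. ?d a b (i, s) = ?d a b (k, t) \<longleftrightarrow> s = t \<and> int p dvd k - i"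
    "\<And>i s k t. ?d a b (i, s) \<otimes>\<^bsub>G\<^esub> ?d a b (k, t) = ?d a b (if s then i - k else i + k, s \<noteq> t)"
    using group.dihedral_presentation[OF G(1,2,3) p G(4)] by metis
  obtain c d where cd: "range (?e c d) = carrier H"
    "\<And>i s k t. ?e c d (i, s) = ?e c d (k, t) \<longleftrightarrow> s = t \<and> int p dvd k - i"
    "\<And>i s k t. ?e c d (i, s) \<otimes>\<^bsub>H\<^esub> ?e c d (k, t) = ?e c d (if s then i - k else i + k, s \<noteq> t)"
    using group.dihedral_presentation[OF H(1,2,3) p H(4)] by metis
  define f where "f x = ?e c d (inv_into UNIV (?d a b) x)" for x
  have same: "?d a b u = ?d a b v \<longleftrightarrow> ?e c d u = ?e c d v" for u v
    by (cases u; cases v) (simp only: ab(2) cd(2))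
  have f: "f (?d a b u) = ?e c d u" for u
    unfolding f_def using same f_inv_into_f[of "?d a b u" "?d a b" UNIV] by blast
  have "f \<in> hom G H"
  proof (rule homI)
    fix x assume "x \<in> carrier G"
    then show "f x \<in> carrier H" unfolding f_def using cd(1) by blast
  next
    fix x y assume "x \<in> carrier G" "y \<in> carrier G"
    then obtain u v where "x = ?d a b u" "y = ?d a b v" unfolding ab(1)[symmetric] by blast
    then obtain i s k t where "x = ?d a b (i, s)" "y = ?d a b (k, t)" by (cases u; cases v) blast
    then show "f (x \<otimes>\<^bsub>G\<^esub> y) = f x \<otimes>\<^bsub>H\<^esub> f y" by (simp only: f ab(3) cd(3))
  qed
  moreover have "bij_betw f (carrier G) (carrier H)"
    unfolding bij_betw_def ab(1)[symmetric] cd(1)[symmetric]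
    using same f by (auto simp: inj_on_def image_image)
  ultimately show ?thesis by (intro is_isoI isoI)
qed

context group begin

text \<open>
  With \<open>A = \<langle>a\<rangle>\<close> of order \<open>p\<close> and involutions outside, only the identity is isolated. The \<open>p - 1\<close>
  other elements of \<open>A\<close> have the \<open>p\<close> involutions outside \<open>A\<close> as neighbours, and each of these \<open>p\<close>
  involutions is adjacent to all the other \<open>2p - 2\<close> vertices. The sum of \<open>deg x - 2\<close> is therefore
  \<open>(p - 1)(p - 2) + p(2p - 4)\<close>, and an involution outside \<open>A\<close> connects the graph.
\<close>

lemma complement_graph_of_order_two_times_prime:
  assumes fin: "finite (carrier G)" and nc: "\<not> cyclic_group G"
    and p: "Factorial_Ring.prime p" and ordG: "order G = 2 * p"
  shows "2 * (complement_cyclomatic G - 1) = (int p - 2) * (3 * int p - 1)"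
    and "connected (proper_enhanced_power_graph_complement G)"
proof -
  obtain a where a: "a \<in> carrier G" "ord a = p"
    and inv2: "\<And>x. x \<in> carrier G \<Longrightarrow> x \<notin> generate G {a} \<Longrightarrow> ord x = 2"
    by (rule involutions_outside_cyclic_subgroup[OF assms]) blast
  let ?A = "generate G {a}"
  have AG: "?A \<subseteq> carrier G" using generate_subset_carrier[OF a(1)] .
  have finA: "finite ?A" using AG fin finite_subset by blast
  have card_a: "card ?A = p" using generate_pow_card a by simp
  have p1: "1 < p" using p prime_gt_1_nat by blast
  have cyc_b: "generate G {x} = {\<one>, x}" "x \<noteq> \<one>" if x: "x \<in> carrier G" "x \<notin> ?A" for x
  proof -
    show "x \<noteq> \<one>" using x(2) generate.one by metis
    have "{\<one>, x} \<subseteq> generate G {x}" by (auto intro: generate.intros)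
    moreover have "card (generate G {x}) = 2" using generate_pow_card[OF x(1)] inv2 x by simp
    moreover have "card {\<one>, x} = 2" using \<open>x \<noteq> \<one>\<close> by simp
    moreover have "finite (generate G {x})"
      using generate_subset_carrier[OF x(1)] fin finite_subset by blast
    ultimately show "generate G {x} = {\<one>, x}" by (intro card_subset_eq[symmetric]) auto
  qed
  have sub_A: "generate G {z} \<subseteq> ?A" if "z \<in> ?A" for z
    using that generate_subset_iff a(1) AG by blast
  have nbr1: "noncocyclic G \<one> = {}"
  proof -
    have "y \<notin> noncocyclic G \<one>" for y
      using generate.one[of G "{y}"] generate.incl[of y "{y}" G] by (auto simp: noncocyclic_def)
    then show ?thesis by blast
  qed
  have nbrA: "noncocyclic G x = carrier G - ?A" if x: "x \<in> ?A" "x \<noteq> \<one>" for x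
  proof
    show "noncocyclic G x \<subseteq> carrier G - ?A" using x(1) a(1) by (auto simp: noncocyclic_def)
    have "\<not> (x \<in> generate G {z} \<and> y \<in> generate G {z})" if "y \<notin> ?A" "z \<in> carrier G" for y z
    proof (cases "z \<in> ?A")
      case True
      then show ?thesis using sub_A that(1) by blast
    next
      case False
      then show ?thesis using cyc_b(1)[OF that(2) False] x by auto
    qed
    then show "carrier G - ?A \<subseteq> noncocyclic G x" by (auto simp: noncocyclic_def)
  qed
  have nbrB: "noncocyclic G x = carrier G - {\<one>, x}" if x: "x \<in> carrier G" "x \<notin> ?A" for x
  proof -
    have "maximal_cyclic x"
      unfolding maximal_cyclic_def using x sub_A cyc_b by blast
    then show ?thesis using noncocyclic_of_maximal cyc_b[OF x] by simp
  qed
  have cardC: "card (carrier G) = 2 * p" using ordG by (simp add: order_def)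
  have cardB: "card (carrier G - ?A) = p" using finA AG card_a cardC by (simp add: card_Diff_subset)
  have oneA: "\<one> \<in> ?A" by (rule generate.one)
  have ne: "carrier G - ?A \<noteq> {}" using cardB p1 by (metis card.empty not_one_less_zero)
  have N: "outside_cyclicizer G = (?A - {\<one>}) \<union> (carrier G - ?A)"
  proof -
    have "noncocyclic G x \<noteq> {}" if "x \<in> ?A - {\<one>}" for x using that nbrA ne by auto
    moreover have "noncocyclic G x \<noteq> {}" if "x \<in> carrier G - ?A" for x
    proof -
      have "a \<noteq> \<one>" using a p1 ord_eq_1 by fastforce
      moreover have "a \<in> ?A" by (auto intro: generate.incl)
      ultimately show ?thesis using that a(1) nbrB[of x] by blast
    qed
    ultimately show ?thesis using nbr1 AG unfolding outside_cyclicizer_def by blast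
  qed
  let ?f = "\<lambda>x. int (card (noncocyclic G x)) - 2"
  have "sum ?f (?A - {\<one>}) = (\<Sum>x\<in>?A - {\<one>}. int p - 2)"
    using nbrA cardB by (intro sum.cong) auto
  then have "sum ?f (?A - {\<one>}) = (int p - 1) * (int p - 2)"
    using oneA card_a p1 by (simp add: card_Diff_singleton of_nat_diff)
  moreover have "sum ?f (carrier G - ?A) = (\<Sum>x\<in>carrier G - ?A. 2 * int p - 4)"
  proof (rule sum.cong)
    fix x assume x: "x \<in> carrier G - ?A"
    then have "card (carrier G - {\<one>, x}) = 2 * p - 2"
      using cyc_b(2)[of x] fin cardC by (subst card_Diff_subset) auto
    then show "?f x = 2 * int p - 4" using x nbrB[of x] p1 by (simp add: of_nat_diff)
  qed simp
  then have "sum ?f (carrier G - ?A) = int p * (2 * int p - 4)" using cardB by simp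
  moreover have "sum ?f (outside_cyclicizer G) = sum ?f (?A - {\<one>}) + sum ?f (carrier G - ?A)"
    unfolding N using finA fin by (intro sum.union_disjoint) auto
  ultimately show "2 * (complement_cyclomatic G - 1) = (int p - 2) * (3 * int p - 1)"
    using cyclomatic_eq_degree_sum[OF fin] by (simp add: algebra_simps)
  obtain b where b: "b \<in> carrier G" "b \<notin> ?A" using ne by blast
  show "connected (proper_enhanced_power_graph_complement G)"
    unfolding complement_graph_eq
  proof (rule connected_if_universal_vertex)
    show "b \<in> outside_cyclicizer G" using b N by blast
    fix x assume x: "x \<in> outside_cyclicizer G" "x \<noteq> b"
    then have "x \<in> noncocyclic G b" using nbrB[OF b] oneA unfolding N using AG by blast
    then show "\<forall>z\<in>carrier G. \<not> (b \<in> generate G {z} \<and> x \<in> generate G {z})"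
      by (simp add: noncocyclic_def)
  qed blast
qed

lemma cyclic_if_order_prime_or_one:
  assumes fin: "finite (carrier G)" and "order G = 1 \<or> Factorial_Ring.prime (order G)"
  shows "cyclic_group G"
proof (cases "carrier G = {\<one>}")
  case True
  then show ?thesis using cyclic_if_generated_by_element[OF one_closed] generate_one by simp
next
  case False
  then obtain x where x: "x \<in> carrier G" "x \<noteq> \<one>" using one_closed by blast
  have "order G \<noteq> 1" using False one_closed unfolding order_def by (metis card_1_singletonE singletonD)
  then have "ord x = order G"
    using assms(2) x ord_dvd_group_order[OF x(1)] ord_eq_1[OF x(1)] by (auto simp: prime_nat_iff)
  then have "generate G {x} = carrier G"
    using generate_pow_card[OF x(1)] generate_subset_carrier[OF x(1)] fin
    by (intro card_subset_eq) (auto simp: order_def)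
  then show ?thesis using cyclic_if_generated_by_element x(1) by blast
qed

end

section \<open>The two exceptional groups\<close>

lemma klein_four:
  "group (integer_mod_group 2 \<times>\<times> integer_mod_group 2)" (is "group ?V")
  "finite (carrier (integer_mod_group 2 \<times>\<times> integer_mod_group 2))"
  "\<not> cyclic_group (integer_mod_group 2 \<times>\<times> integer_mod_group 2)"
  "order (integer_mod_group 2 \<times>\<times> integer_mod_group 2) = 4"
proof -
  show g: "group ?V" by (simp add: DirProd_group)
  interpret V: group ?V by (rule g)
  have C: "carrier ?V = {0..<2} \<times> {0..<2}" by (simp add: carrier_integer_mod_group)
  show fin: "finite (carrier ?V)" unfolding C by simp
  show ord4: "order ?V = 4" unfolding order_def C by simp
  have sq: "x \<otimes>\<^bsub>?V\<^esub> x = \<one>\<^bsub>?V\<^esub>" for x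
    by (cases x) (simp add: mult_DirProd')
  show "\<not> cyclic_group ?V"
  proof
    assume "cyclic_group ?V"
    then obtain x where x: "x \<in> carrier ?V" "subgroup_generated ?V {x} = ?V"
      unfolding cyclic_group_def by blast
    have "V.ord x = 4" using V.cyclic_order_is_ord[OF x(1)] x(2) ord4 by simp
    moreover have "x [^]\<^bsub>?V\<^esub> (2::nat) = \<one>\<^bsub>?V\<^esub>" using sq[of x] V.l_one[OF x(1)]
      by (simp add: numeral_2_eq_2)
    then have "V.ord x dvd 2" using V.pow_eq_id x(1) by blast
    ultimately show False by simp
  qed
qed

lemma symmetric_group_three:
  "finite (carrier (sym_group 3))" "\<not> cyclic_group (sym_group 3)" "order (sym_group 3) = 6"
proof -
  have C: "carrier (sym_group 3) = {p. p permutes {1..3}}" by (simp add: sym_group_def)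
  show "finite (carrier (sym_group 3))" unfolding C by (rule finite_permutations) simp
  have "card {p. p permutes {1..3::nat}} = fact 3" by (rule card_permutations) auto
  then show "order (sym_group 3) = 6" unfolding order_def C by (simp add: fact_numeral)
  show "\<not> cyclic_group (sym_group 3)"
  proof
    let ?s = "transpose (1::nat) 2" and ?t = "transpose (2::nat) 3"
    assume "cyclic_group (sym_group 3)"
    then interpret comm_group "sym_group 3"
      using group.cyclic_imp_abelian_group sym_group_is_group by blast
    have "?s \<in> carrier (sym_group 3)" "?t \<in> carrier (sym_group 3)"
      unfolding C by (auto intro: permutes_swap_id)
    then have "?s \<circ> ?t = ?t \<circ> ?s" using m_comm by (simp add: sym_group_def)
    then have "?s (?t 1) = ?t (?s 1)" by (metis comp_apply)
    then show False by (simp add: transpose_def)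
  qed
qed

section \<open>Classification by cyclomatic number\<close>

theorem theorem3p11:
  fixes G :: "('a, 'm) monoid_scheme"
  assumes "group G" and "finite (carrier G)" and "\<not> cyclic_group G"
  shows "(unicyclic (proper_enhanced_power_graph_complement G) \<longleftrightarrow>
           G \<cong> integer_mod_group 2 \<times>\<times> integer_mod_group 2) \<and>
         (pentacyclic (proper_enhanced_power_graph_complement G) \<longleftrightarrow> G \<cong> sym_group 3) \<and>
         \<not> bicyclic (proper_enhanced_power_graph_complement G) \<and>
         \<not> tricyclic (proper_enhanced_power_graph_complement G) \<and>
         \<not> tetracyclic (proper_enhanced_power_graph_complement G)"
proof -
  let ?\<Gamma> = "proper_enhanced_power_graph_complement G"
  let ?c = "cyclomatic_number ?\<Gamma>"
  have p3: "Factorial_Ring.prime (3::nat)" and p5: "Factorial_Ring.prime (5::nat)"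
    by (auto simp: prime_nat_numeral_eq prime_nat_iff'[of 3] prime_nat_iff'[of 5])
  \<comment> \<open>The values of \<open>1 + (p - 2)(3p - 1) / 2\<close> at \<open>p = 2\<close> and \<open>p = 3\<close>.\<close>
  have four: "?c = 1" "connected ?\<Gamma>" if "order G = 4"
    using group.complement_graph_of_order_two_times_prime[OF assms two_is_prime_nat] that by auto
  have six: "?c = 5" "connected ?\<Gamma>" if "order G = 6"
    using group.complement_graph_of_order_two_times_prime[OF assms p3] that by auto
  have V4: "G \<cong> integer_mod_group 2 \<times>\<times> integer_mod_group 2 \<longleftrightarrow> order G = 4"
  proof
    assume "G \<cong> integer_mod_group 2 \<times>\<times> integer_mod_group 2"
    then show "order G = 4" using iso_same_card klein_four(4) unfolding order_def by metis
  next
    assume "order G = 4"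
    then show "G \<cong> integer_mod_group 2 \<times>\<times> integer_mod_group 2"
      using iso_if_noncyclic_order_two_times_prime[OF assms _ klein_four(1-3) _ two_is_prime_nat]
        klein_four(4) by simp
  qed
  have S3: "G \<cong> sym_group 3 \<longleftrightarrow> order G = 6"
  proof
    assume "G \<cong> sym_group 3"
    then show "order G = 6" using iso_same_card symmetric_group_three(3) unfolding order_def by metis
  next
    assume "order G = 6"
    then show "G \<cong> sym_group 3"
      using iso_if_noncyclic_order_two_times_prime[OF assms _ sym_group_is_group
          symmetric_group_three(1,2) _ p3] symmetric_group_three(3) by simp
  qed
  have small: "order G = 4 \<or> order G = 6" if "?c \<le> 5"
  proof -
    have "3 * (int (order G) - 4) \<le> 2 * (?c - 1)"
      using group.cyclomatic_lower_bound[OF assms] .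
    moreover have "n \<le> 6" if "3 * (int n - 4) \<le> 2 * (c - 1)" "c \<le> 5" for n :: nat and c :: int
      using that by presburger
    ultimately have "order G \<le> 6" using that by blast
    moreover have "order G \<noteq> 0"
      using assms(1,2) group.is_monoid monoid.order_gt_0_iff_finite by fastforce
    moreover have "order G \<noteq> 1" "order G \<noteq> 2" "order G \<noteq> 3" "order G \<noteq> 5"
      using group.cyclic_if_order_prime_or_one[OF assms(1,2)] assms(3) two_is_prime_nat p3 p5 by auto
    moreover have "n = 4 \<or> n = 6"
      if "n \<le> 6" "n \<noteq> 0" "n \<noteq> 1" "n \<noteq> 2" "n \<noteq> 3" "n \<noteq> 5" for n :: nat
      using that by presburger
    ultimately show ?thesis by blast
  qed
  show ?thesis
    unfolding unicyclic_def bicyclic_def tricyclic_def tetracyclic_def pentacyclic_def V4 S3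
    using small four six by auto
qed

end
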